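(* Let $X$ be a real or complex separable Banach space and let $T$ be a bounded linear operator on $X$ which is an operator of Read's type (in the sense defined in the context). Suppose that $T$ has no non-trivial invariant closed subset, i.e. the only closed subsets $F\subseteq X$ with $T(F)\subseteq F$ are $\emptyset$, $\{0\}$ and $X$ (equivalently, for every non-zero $x\in X$ the orbit $\{T^{n}x : n\ge 0\}$ is dense in $X$). Then the operator $T\oplus T$ is hypercyclic on $X\oplus X$; that is (equivalently), $T$ satisfies the Hypercyclicity Criterion.
   Context: **Hypercyclicity.** A bounded operator $S$ on a separable Banach space $Y$ is hypercyclic if there exists $y\in Y$ whose orbit $\{S^{n}y : n\ge 0\}$ is dense in $Y$. The operator $T\oplus T$ acts on $X\oplus X$ by $(T\oplus T)(x,y)=(Tx,Ty)$. **Hypercyclicity Criterion.** $T$ satisfies the Hypercyclicity Criterion if there exist two dense subsets $D,D'$ of $X$, a strictly increasing sequence $(n_k)_{k\ge 0}$ of non-negative integers, and maps $S_{n_k}:D'\to X$, $k\ge 0$, such that (i) $T^{n_k}x\to 0$ as $k\to\infty$ for every $x\in D$; (ii) $S_{n_k}y\to 0$ as $k\to\infty$ for every $y\in D'$; (iii) $T^{n_k}S_{n_k}y\to y$ as $k\to\infty$ for every $y\in D'$. By a known theorem of Bès and Peris, $T$ satisfies the Hypercyclicity Criterion if and only if $T\oplus T$ is hypercyclic. **Operators of Read's type.** Polynomials have coefficients in the scalar field of $X$, and for a polynomial $p$, $|p|$ denotes the sum of the moduli of its coefficients. A bounded operator $T$ on $X$ is said to be of Read's type (with the structure used for operators without non-trivial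 invariant subset) if there exist a normalized Schauder basis $(f_j)_{j\ge 0}$ of $X$ and a sequence $(e_j)_{j\ge 0}$ of vectors of $X$ such that: 1. $e_0=f_0$, $\mathrm{span}[e_0,\dots,e_j]=\mathrm{span}[f_0,\dots,f_j]$ for every $j\ge 1$, and $Te_j=e_{j+1}$ for every $j\ge 0$ (so $T^{j}e_0=e_j$ for every $j$); 2. there are strictly increasing sequences of positive integers $(\nu_n)_{n\ge 1}$ and $(c_n)_{n\ge 1}$, with $\nu_n+1<c_n$ and $c_n$ extremely large with respect to $\nu_n$, in the sense that $\nu_n/\sqrt{c_n}\to 0$ as $n\to\infty$, such that for every $n\ge 1$ the interval $[\nu_n+1,c_n-1]$ is a "lay-off interval": putting $l_n=c_n-\nu_n-1$ (its length), one has $$e_j=2^{-\frac{1}{\sqrt{l_n}}\left(\frac{l_n}{2}+\nu_n+1-j\right)}f_j\qquad\text{for every integer } j \text{ with } \nu_n+1\le j\le c_n-1;$$ 3. there are positive real numbers $\gamma_n$ with $\gamma_n\to 0$ as $n\to\infty$, and polynomials $p_n$ with $|p_n|\le 2$, such that for every $n\ge 1$ $$e_{c_n}=T^{c_n}e_0=\gamma_n f_{c_n}+p_n(T)e_0,$$ and such that for every polynomial $p$ with $|p|\le 2$ and every $\varepsilon>0$ there exists $n\ge 1$ with $\|p_n(T)e_0-p(T)e_0\|<\varepsilon$. *)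

theory Defs
  imports "HOL-Analysis.Analysis" "HOL-Computational_Algebra.Polynomial"
begin

(* The library has no normed vector spaces over a scalar field other than the reals, so the scalar
   multiplication of X is explicit. The instances of the two sort constraints on 'k are the types
   real and complex (up to isometric isomorphism, these are the only ones, by Frobenius's theorem),
   so X is a real or complex Banach space. Its completeness comes from the class banach, and the last
   axiom makes the real vector space structure of that class the restriction of smul. *)
locale banach_space_over = vector_space smul
  for smul :: "'k::{real_normed_field,euclidean_space} \<Rightarrow> 'x::banach \<Rightarrow> 'x" +
  assumes norm_smul: "norm (smul a x) = norm a * norm x"
    and smul_of_real: "smul (of_real r) x = r *\<^sub>R x"

definition bounded_operator ::
    "('k::{real_normed_field,euclidean_space} \<Rightarrow> 'x::banach \<Rightarrow> 'x) \<Rightarrow> ('x \<Rightarrow> 'x) \<Rightarrow> bool" where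
  "bounded_operator smul T \<longleftrightarrow>
     Vector_Spaces.linear smul smul T \<and> (\<exists>K. \<forall>x. norm (T x) \<le> K * norm x)"

definition dense_set :: "'a::topological_space set \<Rightarrow> bool" where
  "dense_set D \<longleftrightarrow> closure D = UNIV"

definition hypercyclic :: "('a::topological_space \<Rightarrow> 'a) \<Rightarrow> bool" where
  "hypercyclic S \<longleftrightarrow> (\<exists>y. dense_set {(S ^^ n) y | n. True})"

(* The maps S m matter only for m in the range of nk and on D'; nothing is required of them
   elsewhere, so total functions can be used. *)
definition hypercyclicity_criterion :: "('x::real_normed_vector \<Rightarrow> 'x) \<Rightarrow> bool" where
  "hypercyclicity_criterion T \<longleftrightarrow>
     (\<exists>D D' (nk :: nat \<Rightarrow> nat) (S :: nat \<Rightarrow> 'x \<Rightarrow> 'x).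
        dense_set D \<and> dense_set D' \<and> strict_mono nk \<and>
        (\<forall>x\<in>D. (\<lambda>k. (T ^^ nk k) x) \<longlonglongrightarrow> 0) \<and>
        (\<forall>y\<in>D'. (\<lambda>k. S (nk k) y) \<longlonglongrightarrow> 0) \<and>
        (\<forall>y\<in>D'. (\<lambda>k. (T ^^ nk k) (S (nk k) y)) \<longlonglongrightarrow> y))"

definition normalized_schauder_basis ::
    "('k::{real_normed_field,euclidean_space} \<Rightarrow> 'x::banach \<Rightarrow> 'x) \<Rightarrow> (nat \<Rightarrow> 'x) \<Rightarrow> bool" where
  "normalized_schauder_basis smul f \<longleftrightarrow>
     (\<forall>x. \<exists>!a :: nat \<Rightarrow> 'k. (\<lambda>j. smul (a j) (f j)) sums x) \<and> (\<forall>j. norm (f j) = 1)"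

definition poly_abs :: "'k::real_normed_field poly \<Rightarrow> real" where
  "poly_abs p = (\<Sum>i\<le>degree p. norm (coeff p i))"

definition poly_op ::
    "('k::{real_normed_field,euclidean_space} \<Rightarrow> 'x::banach \<Rightarrow> 'x) \<Rightarrow> 'k poly \<Rightarrow> ('x \<Rightarrow> 'x) \<Rightarrow> 'x \<Rightarrow> 'x" where
  "poly_op smul p T x = (\<Sum>i\<le>degree p. smul (coeff p i) ((T ^^ i) x))"

(* The sequences \<nu>, c, \<gamma> and p are indexed from 1; their values at 0 are irrelevant. *)
definition read_type ::
    "('k::{real_normed_field,euclidean_space} \<Rightarrow> 'x::banach \<Rightarrow> 'x) \<Rightarrow> ('x \<Rightarrow> 'x) \<Rightarrow> bool" where
  "read_type smul T \<longleftrightarrow>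
     (\<exists>(f :: nat \<Rightarrow> 'x) (e :: nat \<Rightarrow> 'x) (\<nu> :: nat \<Rightarrow> nat) (c :: nat \<Rightarrow> nat)
        (\<gamma> :: nat \<Rightarrow> real) (p :: nat \<Rightarrow> 'k poly).
        normalized_schauder_basis smul f \<and>
        e 0 = f 0 \<and>
        (\<forall>j\<ge>1. module.span smul (e ` {0..j}) = module.span smul (f ` {0..j})) \<and>
        (\<forall>j. T (e j) = e (Suc j)) \<and>
        strict_mono_on {1..} \<nu> \<and> strict_mono_on {1..} c \<and>
        (\<forall>n\<ge>1. 0 < \<nu> n \<and> \<nu> n + 1 < c n) \<and>
        (\<lambda>n. real (\<nu> n) / sqrt (real (c n))) \<longlonglongrightarrow> 0 \<and>
        (\<forall>n\<ge>1. \<forall>j\<in>{\<nu> n + 1..c n - 1}.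
           let l = real (c n) - real (\<nu> n) - 1
           in e j = (2 powr (- (1 / sqrt l) * (l / 2 + real (\<nu> n) + 1 - real j))) *\<^sub>R f j) \<and>
        (\<forall>n\<ge>1. 0 < \<gamma> n) \<and> \<gamma> \<longlonglongrightarrow> 0 \<and>
        (\<forall>n\<ge>1. poly_abs (p n) \<le> 2) \<and>
        (\<forall>n\<ge>1. e (c n) = \<gamma> n *\<^sub>R f (c n) + poly_op smul (p n) T (e 0)) \<and>
        (\<forall>q. poly_abs q \<le> 2 \<longrightarrow>
           (\<forall>\<epsilon>>0. \<exists>n\<ge>1. norm (poly_op smul (p n) T (e 0) - poly_op smul q T (e 0)) < \<epsilon>)))"

end

theory Submission
  imports Defs
begin

text \<open>
  Write \<open>x = e\<^sub>0\<close>. Since \<open>T\<close> has no non-trivial invariant closed subset, the orbit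
  \<open>e\<^sub>j = T\<^sup>j x\<close> is dense. The claim reduces to finding, for every \<open>\<epsilon> > 0\<close>, arbitrarily large \<open>m\<close>
  and a vector \<open>w\<close> such that \<open>w\<close>, \<open>T\<^sup>m x\<close> and \<open>T\<^sup>m w - x\<close> all have norm below \<open>\<epsilon>\<close>: as \<open>T\<close>
  commutes with its powers, the vectors \<open>T\<^sup>j w\<close> are then approximate preimages of \<open>T\<^sup>j x\<close> under
  \<open>T\<^sup>m\<close>, and the Hypercyclicity Criterion holds with both dense sets equal to the orbit
  (\<open>hypercyclicity_criterion_of_dense_orbit\<close>). The Criterion makes \<open>T \<oplus> T\<close> topologically
  transitive, hence hypercyclic by Baire's theorem
  (\<open>hypercyclicity_criterion_imp_hypercyclic_sum\<close>).

  The pairs \<open>(m, w)\<close> come from splitting \<open>c\<^sub>n = m + (c\<^sub>n - m)\<close> with both summands inside the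
  lay-off interval. There the norm of \<open>e\<^sub>j\<close> grows geometrically, with ratio \<open>2\<close> to the power
  \<open>1 / sqrt l\<^sub>n\<close>, and equals 1 in the middle. So for \<open>m\<close> about \<open>k sqrt l\<^sub>n\<close> places below the middle,
  \<open>e\<^sub>m\<close> has norm at most \<open>2\<^sup>-\<^sup>k\<close>, while its mirror image \<open>e\<close> at \<open>c\<^sub>n - m\<close>
  has norm at most \<open>2\<^sup>k\<close> (\<open>layoff_split\<close>). This mirror vector is large, but it can be divided by a
  huge scalar, because \<open>T\<^sup>m\<close> maps it to \<open>e\<close> at \<open>c\<^sub>n\<close>, and this may be chosen close to any
  given vector, in particular to \<open>K x\<close> with \<open>K \<ge> 4\<^sup>k\<close>: the polynomials \<open>p\<^sub>n\<close> approximate every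
  monomial \<open>X\<^sup>i\<close> at \<open>x\<close>, and the orbit of \<open>x\<close> is dense. Then \<open>w\<close>, the mirror vector divided by
  \<open>K\<close>, has norm at most \<open>2\<^sup>-\<^sup>k\<close>, and \<open>T\<^sup>m w\<close> is within \<open>2 / K\<close> of \<open>x\<close>
  (\<open>read_type_return\<close>).
\<close>

section \<open>Topological transitivity and hypercyclicity\<close>

lemma dense_setD_ball:
  fixes D :: "'a::metric_space set"
  assumes "dense_set D" "0 < \<epsilon>"
  obtains d where "d \<in> D" "dist d x < \<epsilon>"
proof -
  have "x \<in> closure D"
    using assms(1) unfolding dense_set_def by simp
  then show ?thesis
    using assms(2) that unfolding closure_approachable by blast
qed

lemma dense_setI_ball:
  fixes D :: "'a::metric_space set"
  assumes "\<And>x \<epsilon>. 0 < \<epsilon> \<Longrightarrow> \<exists>d\<in>D. dist d x < \<epsilon>"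
  shows "dense_set D"
  using assms unfolding dense_set_def closure_approachable set_eq_iff by simp

text \<open>
  Birkhoff's transitivity theorem. A point has dense orbit as soon as its orbit meets each ball of a
  countable family that forms a base. For one ball, the points whose orbit meets it form an open
  set, dense by transitivity, so Baire's theorem supplies a point that works for all the balls.
\<close>

lemma birkhoff_transitivity:
  fixes S :: "'a::complete_space \<Rightarrow> 'a"
  assumes sep: "separable_space (euclidean :: 'a topology)"
    and cont: "continuous_on UNIV S"
    and trans: "\<And>x y \<epsilon>. 0 < \<epsilon> \<Longrightarrow> \<exists>n z. dist z x < \<epsilon> \<and> dist ((S ^^ n) z) y < \<epsilon>"
  shows "hypercyclic S"
proof -
  obtain C :: "'a set" where C: "countable C" "closure C = UNIV"
    using sep unfolding separable_space_def by auto
  have cont_iter: "continuous_on UNIV (S ^^ n)" for n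
  proof (induction n)
    case (Suc n)
    then show ?case
      unfolding funpow.simps using cont by (intro continuous_on_compose) (auto intro: continuous_on_subset)
  qed (simp add: continuous_on_id')
  define G where "G = (\<lambda>(c, k). \<Union>n. (S ^^ n) -` ball c (1 / real (Suc k)))"
  have open_G: "open (G ck)" for ck
    unfolding G_def by (auto split: prod.split intro!: open_vimage cont_iter)
  have dense_G: "closure (G ck) = UNIV" for ck
  proof -
    obtain c k where ck: "ck = (c, k)" by fastforce
    have "\<exists>z\<in>G ck. dist z x < \<epsilon>" if "0 < \<epsilon>" for x \<epsilon>
    proof -
      obtain n z where "dist z x < min \<epsilon> (1 / real (Suc k))"
        "dist ((S ^^ n) z) c < min \<epsilon> (1 / real (Suc k))"
        using trans[of "min \<epsilon> (1 / real (Suc k))" x c] \<open>0 < \<epsilon>\<close> by auto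
      then show ?thesis
        unfolding ck G_def by (intro bexI[of _ z]) (auto simp: dist_commute)
    qed
    then show ?thesis
      using dense_setI_ball[of "G ck"] unfolding dense_set_def by blast
  qed
  have "euclidean closure_of \<Inter>(G ` (C \<times> UNIV)) = topspace (euclidean :: 'a topology)"
  proof (rule Baire_category)
    show "completely_metrizable_space (euclidean :: 'a topology) \<or>
        locally_compact_space (euclidean :: 'a topology) \<and> regular_space (euclidean :: 'a topology)"
      by (simp add: completely_metrizable_space_euclidean)
    show "countable (G ` (C \<times> UNIV))"
      using C(1) by (intro countable_image countable_SIGMA) auto
  qed (use open_G dense_G in auto)
  then have "\<Inter>(G ` (C \<times> UNIV)) \<noteq> {}"
    by auto
  then obtain y where y: "\<And>c k. c \<in> C \<Longrightarrow> y \<in> G (c, k)"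
    by auto
  have "\<exists>d\<in>{(S ^^ n) y | n. True}. dist d x < \<epsilon>" if "0 < \<epsilon>" for x \<epsilon>
  proof -
    obtain c where c: "c \<in> C" "dist c x < \<epsilon> / 2"
      using dense_setD_ball[of C "\<epsilon> / 2" x] C(2) \<open>0 < \<epsilon>\<close> unfolding dense_set_def by auto
    obtain k where k: "1 / real (Suc k) < \<epsilon> / 2"
      using nat_approx_posE[of "\<epsilon> / 2"] \<open>0 < \<epsilon>\<close> by auto
    obtain n where "dist c ((S ^^ n) y) < 1 / real (Suc k)"
      using y[OF c(1), of k] unfolding G_def by auto
    then have "dist ((S ^^ n) y) x < \<epsilon>"
      using c(2) k by (metis dist_commute dist_triangle_half_r less_trans)
    then show ?thesis by blast
  qed
  then show ?thesis
    unfolding hypercyclic_def using dense_setI_ball by blast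
qed

section \<open>The Hypercyclicity Criterion\<close>

lemma bounded_linear_funpow:
  fixes T :: "'a::real_normed_vector \<Rightarrow> 'a"
  assumes "bounded_linear T"
  shows "bounded_linear (T ^^ n)"
proof (induction n)
  case (Suc n)
  then show ?case
    using bounded_linear_compose[OF assms Suc] by (simp add: comp_def)
qed (simp add: bounded_linear_ident id_def)

lemma funpow_map_prod:
  fixes f :: "'a \<Rightarrow> 'a" and g :: "'b \<Rightarrow> 'b"
  shows "(map_prod f g ^^ n) (x, y) = ((f ^^ n) x, (g ^^ n) y)"
  by (induction n) auto

lemma separable_space_prod:
  assumes "separable_space (euclidean :: 'a::metric_space topology)"
  shows "separable_space (euclidean :: ('a \<times> 'a) topology)"
proof -
  obtain C :: "'a set" where C: "countable C" "closure C = UNIV"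
    using assms unfolding separable_space_def by auto
  then have "countable (C \<times> C)" "closure (C \<times> C) = UNIV"
    by (auto simp: closure_Times)
  then show ?thesis
    unfolding separable_space_def by (intro exI[of _ "C \<times> C"]) auto
qed

text \<open>
  The vector \<open>u + S v\<close>, with \<open>u\<close> in the first dense set and \<open>v\<close> in the second, stays near \<open>u\<close> and is
  moved by \<open>T\<close> to the power \<open>n\<^sub>k\<close> near \<open>v\<close>, for all large \<open>k\<close>. Two such requirements, one for each
  coordinate of \<open>T \<oplus> T\<close>, can therefore be met with the same \<open>k\<close>; this gives transitivity.
\<close>

lemma hypercyclicity_criterion_imp_hypercyclic_sum:
  fixes T :: "'x::banach \<Rightarrow> 'x"
  assumes sep: "separable_space (euclidean :: 'x topology)"
    and T: "bounded_linear T"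
    and crit: "hypercyclicity_criterion T"
  shows "hypercyclic (map_prod T T)"
proof (rule birkhoff_transitivity)
  show "separable_space (euclidean :: ('x \<times> 'x) topology)"
    using sep by (rule separable_space_prod)
  show "continuous_on UNIV (map_prod T T)"
    unfolding map_prod_def case_prod_beta
    by (intro continuous_on_Pair linear_continuous_on bounded_linear_compose[OF T]
        bounded_linear_fst bounded_linear_snd)
next
  obtain D D' nk S where D: "dense_set D" "dense_set D'"
    and zero: "\<And>x. x \<in> D \<Longrightarrow> (\<lambda>k. (T ^^ nk k) x) \<longlonglongrightarrow> 0"
    and small: "\<And>y. y \<in> D' \<Longrightarrow> (\<lambda>k. S (nk k) y) \<longlonglongrightarrow> 0"
    and forth: "\<And>y. y \<in> D' \<Longrightarrow> (\<lambda>k. (T ^^ nk k) (S (nk k) y)) \<longlonglongrightarrow> y"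
    using crit unfolding hypercyclicity_criterion_def by blast
  have single: "\<exists>z. (\<forall>\<^sub>F k in sequentially. dist (z k) x < \<epsilon> \<and> dist ((T ^^ nk k) (z k)) y < \<epsilon>)"
    if eps: "0 < \<epsilon>" for x y :: 'x and \<epsilon>
  proof -
    obtain u v where u: "u \<in> D" "dist u x < \<epsilon>" and v: "v \<in> D'" "dist v y < \<epsilon>"
      using dense_setD_ball[OF D(1) eps, of x] dense_setD_ball[OF D(2) eps, of y] by metis
    define z where "z k = u + S (nk k) v" for k
    have "z \<longlonglongrightarrow> u"
      unfolding z_def using tendsto_add[OF tendsto_const small[OF v(1)]] by simp
    moreover have "(\<lambda>k. (T ^^ nk k) (z k)) \<longlonglongrightarrow> v"
      unfolding z_def linear_simps(1)[OF bounded_linear_funpow[OF T]]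
      using tendsto_add[OF zero[OF u(1)] forth[OF v(1)]] by simp
    ultimately have "(\<lambda>k. dist (z k) x) \<longlonglongrightarrow> dist u x" "(\<lambda>k. dist ((T ^^ nk k) (z k)) y) \<longlonglongrightarrow> dist v y"
      by (auto intro: tendsto_intros)
    then show ?thesis
      using u(2) v(2) by (intro exI[of _ z] eventually_conj) (auto dest: order_tendstoD)
  qed
  fix x y :: "'x \<times> 'x" and \<epsilon> :: real
  assume "0 < \<epsilon>"
  obtain x1 x2 y1 y2 where xy: "x = (x1, x2)" "y = (y1, y2)" by fastforce
  have half: "0 < \<epsilon> / 2" using \<open>0 < \<epsilon>\<close> by simp
  obtain z1 z2 where z: 
    "\<forall>\<^sub>F k in sequentially. dist (z1 k) x1 < \<epsilon>/2 \<and> dist ((T ^^ nk k) (z1 k)) y1 < \<epsilon>/2"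
    "\<forall>\<^sub>F k in sequentially. dist (z2 k) x2 < \<epsilon>/2 \<and> dist ((T ^^ nk k) (z2 k)) y2 < \<epsilon>/2"
    using single[OF half, of x1 y1] single[OF half, of x2 y2] by blast
  obtain k where k: "dist (z1 k) x1 < \<epsilon>/2" "dist ((T ^^ nk k) (z1 k)) y1 < \<epsilon>/2"
    "dist (z2 k) x2 < \<epsilon>/2" "dist ((T ^^ nk k) (z2 k)) y2 < \<epsilon>/2"
    using eventually_happens'[OF sequentially_bot eventually_conj[OF z]] by blast
  have dist_Pair_less: "dist (a, b) (a', b') < \<epsilon>" if "dist a a' < \<epsilon>/2" "dist b b' < \<epsilon>/2"
    for a b a' b' :: 'x
    using sqrt_sum_squares_le_sum_abs[of "dist a a'" "dist b b'"] that
    unfolding dist_Pair_Pair by simp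
  show "\<exists>n z. dist z x < \<epsilon> \<and> dist ((map_prod T T ^^ n) z) y < \<epsilon>"
    unfolding xy using k
    by (intro exI[of _ "nk k"] exI[of _ "(z1 k, z2 k)"]) (simp add: funpow_map_prod dist_Pair_less)
qed

text \<open>
  For a dense orbit it suffices to verify the Criterion at its starting point: applying \<open>T\<^sup>j\<close> to the
  limits obtained for \<open>x\<close> gives them for \<open>T\<^sup>j x\<close>, because \<open>T\<^sup>j\<close> is continuous and commutes with the
  powers of \<open>T\<close>.
\<close>

lemma hypercyclicity_criterion_of_dense_orbit:
  fixes T :: "'x::banach \<Rightarrow> 'x"
  assumes T: "bounded_linear T"
    and dense: "dense_set (range (\<lambda>j. (T ^^ j) x))"
    and step: "\<And>N \<epsilon>. 0 < \<epsilon> \<Longrightarrow>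
      \<exists>m>N. \<exists>w. norm w < \<epsilon> \<and> norm ((T ^^ m) w - x) < \<epsilon> \<and> norm ((T ^^ m) x) < \<epsilon>"
  shows "hypercyclicity_criterion T"
proof -
  define P where "P k mw \<longleftrightarrow> norm (snd mw) < 1 / real (Suc k) \<and>
      norm ((T ^^ fst mw) (snd mw) - x) < 1 / real (Suc k) \<and>
      norm ((T ^^ fst mw) x) < 1 / real (Suc k)" for k and mw :: "nat \<times> 'x"
  have ex: "\<exists>mw. P k mw \<and> N < fst mw" for k N
    using step[of "1 / real (Suc k)" N] unfolding P_def by auto
  obtain mw where mw: "\<And>k. P k (mw k)" "\<And>k. fst (mw k) < fst (mw (Suc k))"
    using dependent_nat_choice[of P "\<lambda>_ a b. fst a < fst b"] ex by metis
  define nk where "nk = fst \<circ> mw"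
  define w where "w = snd \<circ> mw"
  have mono: "strict_mono nk"
    using mw(2) by (simp add: strict_mono_Suc_iff nk_def)
  have null: "u \<longlonglongrightarrow> 0" if "\<And>k. norm (u k) < 1 / real (Suc k)" for u :: "nat \<Rightarrow> 'x"
    using LIMSEQ_inverse_real_of_nat that
    by (intro Lim_null_comparison[of u "\<lambda>k. inverse (real (Suc k))"])
       (auto simp: inverse_eq_divide less_imp_le simp del: of_nat_Suc)
  have w: "w \<longlonglongrightarrow> 0" and ret: "(\<lambda>k. (T ^^ nk k) (w k)) \<longlonglongrightarrow> x" and zero: "(\<lambda>k. (T ^^ nk k) x) \<longlonglongrightarrow> 0"
    using mw(1) by (auto simp: P_def nk_def w_def intro!: null LIM_zero_cancel[of _ x])
  have lim: "(\<lambda>k. (T ^^ j) (u k)) \<longlonglongrightarrow> (T ^^ j) a" if "u \<longlonglongrightarrow> a" for u j a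
    using bounded_linear.tendsto[OF bounded_linear_funpow[OF T] that] .
  have comm: "(T ^^ m) ((T ^^ j) z) = (T ^^ j) ((T ^^ m) z)" for m j z
    by (metis add.commute comp_apply funpow_add)
  have zero_iter: "(T ^^ j) 0 = 0" for j
    using linear_simps(3)[OF bounded_linear_funpow[OF T]] .
  \<comment> \<open>The exponent \<open>j\<close> with \<open>y = T\<^sup>j x\<close> may be chosen arbitrarily: any choice gives the limits.\<close>
  define idx where "idx y = (SOME j. y = (T ^^ j) x)" for y
  have idx: "(T ^^ idx y) x = y" if "y \<in> range (\<lambda>j. (T ^^ j) x)" for y
    unfolding idx_def using that by (metis (mono_tags, lifting) rangeE someI_ex)
  define S where "S n y = (T ^^ idx y) (w (inv nk n))" for n y
  have S: "S (nk k) y = (T ^^ idx y) (w k)" for k y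
    unfolding S_def using strict_mono_imp_inj_on[OF mono] by simp
  show ?thesis
    unfolding hypercyclicity_criterion_def
  proof (intro exI conjI ballI)
    fix y assume "y \<in> range (\<lambda>j. (T ^^ j) x)"
    then show "(\<lambda>k. (T ^^ nk k) y) \<longlonglongrightarrow> 0"
      using lim[OF zero] by (auto simp: comm zero_iter)
  next
    fix y
    show "(\<lambda>k. S (nk k) y) \<longlonglongrightarrow> 0"
      using lim[OF w] unfolding S by (simp add: zero_iter)
  next
    fix y assume y: "y \<in> range (\<lambda>j. (T ^^ j) x)"
    show "(\<lambda>k. (T ^^ nk k) (S (nk k) y)) \<longlonglongrightarrow> y"
      using lim[OF ret, of "idx y"] unfolding S comm[of "nk _"] idx[OF y] .
  qed (use dense mono in auto)
qed

section \<open>Lay-off intervals\<close>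

text \<open>
  The factor between \<open>e\<^sub>j\<close> and \<open>f\<^sub>j\<close> on the lay-off interval from \<open>\<nu> + 1\<close> to \<open>c - 1\<close>.
\<close>

definition layoff_weight :: "nat \<Rightarrow> nat \<Rightarrow> nat \<Rightarrow> real" where
  "layoff_weight \<nu> c j =
     (let l = real c - real \<nu> - 1
      in 2 powr (- (1 / sqrt l) * (l / 2 + real \<nu> + 1 - real j)))"

text \<open>
  Let \<open>s = sqrt l\<close>. The exponent of the weight is \<open>-k\<close> at \<open>t = l / 2 + \<nu> + 1 - k s\<close>, which motivates
  taking \<open>m\<close> to be the integer part of \<open>t\<close>. At \<open>c - m = l + \<nu> + 1 - m\<close> the exponent is
  \<open>(l / 2 - m) / s\<close>, which is at most \<open>k\<close> because \<open>m > t - 1\<close>. The hypotheses on \<open>l\<close> keep both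
  indices in the lay-off interval: \<open>2 k \<le> s\<close> gives \<open>t \<ge> \<nu> + 1\<close>, hence \<open>m \<ge> \<nu> + 1\<close>, and
  \<open>\<nu> + 1 \<le> l / 2\<close> gives \<open>m \<le> l\<close>, hence \<open>c - m \<ge> \<nu> + 1\<close>.
\<close>

lemma layoff_split:
  fixes \<nu> c k :: nat
  defines "l \<equiv> real c - real \<nu> - 1"
  assumes wide: "real \<nu> + 1 \<le> l / 2" and k: "2 * real k \<le> sqrt l"
  obtains m where "m \<in> {\<nu> + 1..c - 1}" "c - m \<in> {\<nu> + 1..c - 1}" "m \<le> c"
    "layoff_weight \<nu> c m \<le> 1 / 2 ^ k" "layoff_weight \<nu> c (c - m) \<le> 2 ^ k"
proof -
  define s where "s = sqrt l"
  have "0 < l" using wide by linarith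
  then have s: "0 < s" "s * s = l" unfolding s_def by auto
  have ks: "real k * s \<le> l / 2" "0 \<le> real k * s"
    using mult_right_mono[OF k, of s] s unfolding s_def by auto
  define t where "t = l / 2 + real \<nu> + 1 - real k * s"
  define m where "m = nat \<lfloor>t\<rfloor>"
  have "real \<nu> + 1 \<le> t" using ks unfolding t_def by linarith
  then have m: "real m \<le> t" "t < real m + 1" and "\<nu> + 1 \<le> m"
    unfolding m_def by (auto simp: le_nat_iff le_floor_iff)
  have "real m \<le> l"
    using m(1) wide ks(2) unfolding t_def by linarith
  then have ml: "real m + real \<nu> + 1 \<le> real c" unfolding l_def by linarith
  then have ml': "m + \<nu> + 1 \<le> c" by linarith
  have "layoff_weight \<nu> c m \<le> 2 powr (- real k)"
  proof -
    have "real k * s \<le> l / 2 + real \<nu> + 1 - real m"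
      using m(1) unfolding t_def by linarith
    then have "real k \<le> (1 / s) * (l / 2 + real \<nu> + 1 - real m)"
      using s(1) by (simp add: field_simps)
    then show ?thesis
      unfolding layoff_weight_def Let_def l_def[symmetric] s_def[symmetric]
      by (intro powr_mono) auto
  qed
  moreover have "layoff_weight \<nu> c (c - m) \<le> 2 powr (real k)"
  proof -
    have "- (l / 2 + real \<nu> + 1 - real (c - m)) \<le> real k * s"
      using m(2) ml' unfolding t_def l_def by (simp add: of_nat_diff field_simps)
    then have "- (1 / s) * (l / 2 + real \<nu> + 1 - real (c - m)) \<le> real k"
      using s(1) by (simp add: field_simps)
    then show ?thesis
      unfolding layoff_weight_def Let_def l_def[symmetric] s_def[symmetric]
      by (intro powr_mono) auto
  qed
  moreover have "m \<in> {\<nu> + 1..c - 1}" "c - m \<in> {\<nu> + 1..c - 1}" "m \<le> c"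
    using \<open>\<nu> + 1 \<le> m\<close> ml' by auto
  ultimately show ?thesis
    using that[of m] by (simp add: powr_minus powr_realpow inverse_eq_divide)
qed

text \<open>
  The condition that \<open>c\<^sub>n\<close> is extremely large with respect to \<open>\<nu>\<^sub>n\<close> makes the length of the lay-off
  interval comparable with \<open>c\<^sub>n\<close>, which is what \<open>layoff_split\<close> asks for.
\<close>

lemma eventually_layoff_wide:
  fixes \<nu> c :: "nat \<Rightarrow> nat" and k :: nat
  assumes lim: "(\<lambda>n. real (\<nu> n) / sqrt (real (c n))) \<longlonglongrightarrow> 0"
    and c: "filterlim c at_top sequentially"
  shows "\<forall>\<^sub>F n in sequentially.
      real (\<nu> n) + 1 \<le> (real (c n) - real (\<nu> n) - 1) / 2 \<and>
      2 * real k \<le> sqrt (real (c n) - real (\<nu> n) - 1)"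
proof -
  have "\<forall>\<^sub>F n in sequentially. real (\<nu> n) / sqrt (real (c n)) < 1"
    using order_tendstoD(2)[OF lim] by simp
  \<comment> \<open>With \<open>r = sqrt (c n)\<close>, this bound makes \<open>r\<^sup>2 - r - 1\<close> exceed both \<open>2 (r + 1)\<close> and \<open>(2 k)\<^sup>2\<close>.\<close>
  moreover have "\<forall>\<^sub>F n in sequentially. (4 + 4 * k)\<^sup>2 \<le> c n"
    using c unfolding filterlim_at_top by blast
  ultimately show ?thesis
  proof eventually_elim
    case (elim n)
    define r where "r = sqrt (real (c n))"
    have "(4 + 4 * real k)\<^sup>2 \<le> real (c n)"
      using elim(2) by (metis (mono_tags, lifting) of_nat_add of_nat_le_iff of_nat_mult of_nat_numeral of_nat_power)
    then have r: "4 + 4 * real k \<le> r"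
      unfolding r_def by (rule real_le_rsqrt)
    have rr: "r * r = real (c n)" unfolding r_def by simp
    have \<nu>: "real (\<nu> n) \<le> r"
      using elim(1) r unfolding r_def[symmetric] by (simp add: field_simps)
    have "(4 + 4 * real k) * r \<le> r * r" "real k * (4 + 4 * real k) \<le> real k * r"
      using r by (auto intro!: mult_mono)
    then have "4 * r + 16 * real k + 16 * (real k * real k) \<le> real (c n)"
      unfolding rr by (simp add: algebra_simps)
    moreover have "(2 * real k)\<^sup>2 \<le> 16 * (real k * real k)" "0 \<le> (2 * real k)\<^sup>2"
      by (simp_all add: power2_eq_square)
    ultimately have "4 * r + 16 * real k + (2 * real k)\<^sup>2 \<le> real (c n)" "0 \<le> (2 * real k)\<^sup>2"
      by linarith+
    moreover have "4 \<le> r" "0 \<le> real k"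
      using r by simp_all
    ultimately have "3 * real (\<nu> n) + 3 \<le> real (c n)"
      "(2 * real k)\<^sup>2 \<le> real (c n) - real (\<nu> n) - 1"
      using \<nu> by linarith+
    then show ?case
      by (auto intro: real_le_rsqrt)
  qed
qed

section \<open>Operators of Read's type\<close>

lemma bounded_operator_imp_bounded_linear:
  assumes "banach_space_over smul" "bounded_operator smul T"
  shows "bounded_linear T"
proof -
  interpret banach_space_over smul by fact
  from assms(2) obtain K where lin: "Vector_Spaces.linear smul smul T"
    and K: "\<And>x. norm (T x) \<le> norm x * K"
    unfolding bounded_operator_def by (auto simp: mult.commute)
  interpret Vector_Spaces.linear smul smul T by (rule lin)
  show ?thesis
    by (rule bounded_linear_intro[OF _ _ K]) (simp_all add: add smul_of_real[symmetric] scale)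
qed

lemma poly_op_monom:
  assumes "banach_space_over smul"
  shows "poly_op smul (monom 1 i) T x = (T ^^ i) x"
proof -
  interpret banach_space_over smul by fact
  have "poly_op smul (monom 1 i) T x = (\<Sum>j\<le>i. if j = i then (T ^^ i) x else 0)"
    unfolding poly_op_def degree_monom_eq[OF one_neq_zero] by (intro sum.cong) auto
  then show ?thesis by simp
qed

lemma poly_abs_monom_one: "poly_abs (monom 1 i) = 1"
proof -
  have "poly_abs (monom (1::'a) i) = (\<Sum>j\<le>i. if j = i then 1 else 0)"
    unfolding poly_abs_def degree_monom_eq[OF one_neq_zero] by (intro sum.cong) auto
  then show ?thesis by simp
qed

text \<open>The closure of the orbit is invariant by continuity, and it contains \<open>x \<noteq> 0\<close>.\<close>

lemma dense_orbit_if_no_invariant_subset: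
  fixes T :: "'x::real_normed_vector \<Rightarrow> 'x"
  assumes T: "bounded_linear T" and "x \<noteq> 0"
    and inv: "\<And>F. closed F \<Longrightarrow> T ` F \<subseteq> F \<Longrightarrow> F = {} \<or> F = {0} \<or> F = UNIV"
  shows "dense_set (range (\<lambda>j. (T ^^ j) x))"
proof -
  let ?O = "range (\<lambda>j. (T ^^ j) x)"
  have "T ` ?O \<subseteq> ?O"
  proof clarify
    fix j
    show "T ((T ^^ j) x) \<in> ?O"
      using range_eqI[of _ "\<lambda>j. (T ^^ j) x" "Suc j"] by simp
  qed
  then have "T ` closure ?O \<subseteq> closure ?O"
    using closure_subset[of ?O]
    by (intro image_closure_subset linear_continuous_on[OF T]) auto
  moreover have "x \<in> closure ?O"
    using closure_subset[of ?O] range_eqI[of x "\<lambda>j. (T ^^ j) x" 0] by auto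
  ultimately show ?thesis
    using inv[of "closure ?O"] \<open>x \<noteq> 0\<close> unfolding dense_set_def by auto
qed

text \<open>
  The index of an approximation must be large for the lay-off estimates to hold, but density alone
  gives no control on it. Approximating a multiple of \<open>x\<close> whose norm exceeds those of the first
  \<open>N\<close> terms by at least 1 rules these terms out.
\<close>

lemma large_multiple_approximation:
  fixes a :: "nat \<Rightarrow> 'x::real_normed_vector"
  assumes dense: "\<And>y \<epsilon>. 0 < \<epsilon> \<Longrightarrow> \<exists>n\<ge>1. norm (a n - y) < \<epsilon>" and x: "norm x = 1"
  obtains n K where "N \<le> n" "R \<le> K" "norm (a n - K *\<^sub>R x) < 1"
proof -
  define K where "K = max \<bar>R\<bar> (1 + (\<Sum>n<N. norm (a n)))"
  obtain n where n: "norm (a n - K *\<^sub>R x) < 1"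
    using dense[of 1 "K *\<^sub>R x"] by auto
  have "\<not> n < N"
  proof
    assume "n < N"
    then have "norm (a n) \<le> (\<Sum>n<N. norm (a n))"
      by (intro member_le_sum) auto
    moreover have "norm (K *\<^sub>R x) \<le> norm (a n) + norm (a n - K *\<^sub>R x)"
      by (metis norm_triangle_sub norm_minus_commute)
    ultimately show False
      using n x unfolding K_def by (simp add: max_def split: if_splits)
  qed
  then show ?thesis
    using that[of n K] n unfolding K_def by simp
qed

lemma nat_le_strict_mono_on_positive:
  fixes g :: "nat \<Rightarrow> nat"
  assumes "strict_mono_on {1..} g" "1 \<le> n" "0 < g 1"
  shows "n \<le> g n"
  using assms(2)
proof (induction n rule: nat_induct_at_least)
  case base
  then show ?case using assms(3) by simp
next
  case (Suc n)
  have "g n < g (Suc n)"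
    using Suc.hyps by (intro strict_mono_onD[OF assms(1)]) auto
  then show ?case using Suc.IH by simp
qed

text \<open>
  The heart of the argument: the small vectors \<open>w\<close> that return to \<open>x = e\<^sub>0\<close> at a time \<open>m\<close> when
  \<open>T\<^sup>m x\<close> is itself small.
\<close>

lemma read_type_return:
  fixes smul :: "'k::{real_normed_field,euclidean_space} \<Rightarrow> 'x::banach \<Rightarrow> 'x"
  assumes space: "banach_space_over smul"
    and T: "bounded_operator smul T"
    and read: "read_type smul T"
    and inv: "\<And>F. closed F \<Longrightarrow> T ` F \<subseteq> F \<Longrightarrow> F = {} \<or> F = {0} \<or> F = UNIV"
  obtains x where "dense_set (range (\<lambda>j. (T ^^ j) x))"
    and "\<And>N \<epsilon>. 0 < \<epsilon> \<Longrightarrow>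
      \<exists>m>N. \<exists>w. norm w < \<epsilon> \<and> norm ((T ^^ m) w - x) < \<epsilon> \<and> norm ((T ^^ m) x) < \<epsilon>"
proof -
  note bl = bounded_operator_imp_bounded_linear[OF space T]
  obtain f :: "nat \<Rightarrow> 'x" and e :: "nat \<Rightarrow> 'x" and \<nu> c :: "nat \<Rightarrow> nat" and \<gamma> :: "nat \<Rightarrow> real"
    and p :: "nat \<Rightarrow> 'k poly"
    where basis: "normalized_schauder_basis smul f" and e0: "e 0 = f 0"
    and Te: "\<And>j. T (e j) = e (Suc j)"
    and mono: "strict_mono_on {1..} \<nu>" "strict_mono_on {1..} c"
    and \<nu>c: "\<And>n. n \<ge> 1 \<Longrightarrow> 0 < \<nu> n \<and> \<nu> n + 1 < c n"
    and lim: "(\<lambda>n. real (\<nu> n) / sqrt (real (c n))) \<longlonglongrightarrow> 0"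
    and layoff: "\<And>n j. n \<ge> 1 \<Longrightarrow> j \<in> {\<nu> n + 1..c n - 1} \<Longrightarrow> e j = layoff_weight (\<nu> n) (c n) j *\<^sub>R f j"
    and \<gamma>: "\<And>n. n \<ge> 1 \<Longrightarrow> 0 < \<gamma> n" "\<gamma> \<longlonglongrightarrow> 0"
    and ec: "\<And>n. n \<ge> 1 \<Longrightarrow> e (c n) = \<gamma> n *\<^sub>R f (c n) + poly_op smul (p n) T (e 0)"
    and p: "\<And>q \<epsilon>. poly_abs q \<le> 2 \<Longrightarrow> 0 < \<epsilon> \<Longrightarrow>
        \<exists>n\<ge>1. norm (poly_op smul (p n) T (e 0) - poly_op smul q T (e 0)) < \<epsilon>"
    using read unfolding read_type_def
  proof (elim exE conjE, goal_cases)
    case prems: (1 f e \<nu> c \<gamma> p)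
    show ?case
    proof (rule prems(1)[of f e \<nu> c \<gamma> p], goal_cases)
      case (8 n j)
      then show ?case
        using prems(10) unfolding layoff_weight_def Let_def by blast
    qed (use prems(2-9,11-) in \<open>assumption | blast\<close>)+
  qed
  have norm_f: "norm (f j) = 1" for j
    using basis unfolding normalized_schauder_basis_def by blast
  have e: "(T ^^ i) (e j) = e (i + j)" for i j
    by (induction i) (auto simp: Te)
  have e0_norm: "norm (e 0) = 1" using e0 norm_f by simp
  have dense: "dense_set (range (\<lambda>j. (T ^^ j) (e 0)))"
    using bl inv e0_norm by (intro dense_orbit_if_no_invariant_subset) auto
  define a where "a n = poly_op smul (p n) T (e 0)" for n
  have dense_a: "\<exists>n\<ge>1. norm (a n - y) < \<epsilon>" if "0 < \<epsilon>" for y \<epsilon>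
  proof -
    obtain i where i: "dist ((T ^^ i) (e 0)) y < \<epsilon> / 2"
      using dense_setD_ball[OF dense, of "\<epsilon> / 2" y] \<open>0 < \<epsilon>\<close> by auto
    obtain n where "n \<ge> 1" "norm (a n - (T ^^ i) (e 0)) < \<epsilon> / 2"
      using p[of "monom 1 i" "\<epsilon> / 2"] \<open>0 < \<epsilon>\<close>
      unfolding a_def poly_op_monom[OF space] poly_abs_monom_one by auto
    then show ?thesis
      using i norm_triangle_ineq[of "a n - (T ^^ i) (e 0)" "(T ^^ i) (e 0) - y"]
      by (intro exI[of _ n]) (auto simp: dist_norm)
  qed
  have "\<forall>\<^sub>F n in sequentially. n \<le> c n"
    using nat_le_strict_mono_on_positive[OF mono(2)] \<nu>c[of 1]
    unfolding eventually_sequentially by (metis gr0I less_zeroE order_refl)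
  then have c_lim: "filterlim c at_top sequentially"
    by (rule filterlim_at_top_mono[OF filterlim_ident])
  have "\<exists>m>N. \<exists>w. norm w < \<epsilon> \<and> norm ((T ^^ m) w - e 0) < \<epsilon> \<and> norm ((T ^^ m) (e 0)) < \<epsilon>"
    if "0 < \<epsilon>" for N \<epsilon>
  proof -
    obtain k where k: "(1 / 2) ^ k < \<epsilon>"
      using real_arch_pow_inv[OF \<open>0 < \<epsilon>\<close>, of "1 / 2"] by auto
    have "\<forall>\<^sub>F n in sequentially. \<gamma> n < 1 \<and>
        real (\<nu> n) + 1 \<le> (real (c n) - real (\<nu> n) - 1) / 2 \<and>
        2 * real k \<le> sqrt (real (c n) - real (\<nu> n) - 1)"
      using order_tendstoD(2)[OF \<gamma>(2), of 1]
      by (intro eventually_conj eventually_layoff_wide[OF lim c_lim]) simp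
    then obtain M where M: "\<And>n. n \<ge> M \<Longrightarrow> \<gamma> n < 1 \<and>
        real (\<nu> n) + 1 \<le> (real (c n) - real (\<nu> n) - 1) / 2 \<and>
        2 * real k \<le> sqrt (real (c n) - real (\<nu> n) - 1)"
      unfolding eventually_sequentially by blast
    \<comment> \<open>The bound \<open>4\<^sup>k\<close> absorbs the norm \<open>2\<^sup>k\<close> of the mirror vector and still leaves a factor
      \<open>2\<^sup>-\<^sup>k\<close>; the bound \<open>2 / \<epsilon>\<close> makes the error \<open>(\<gamma>\<^sub>n + 1) / K\<close> small.\<close>
    obtain n K where n: "max M (N + 1) \<le> n" and K: "max (4 ^ k) (2 / \<epsilon> + 1) \<le> K"
      and aK: "norm (a n - K *\<^sub>R e 0) < 1"
      using large_multiple_approximation[OF dense_a e0_norm] by metis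
    have n': "M \<le> n" "1 \<le> n" "N < n" using n by auto
    have "2 / \<epsilon> < K" "4 ^ k \<le> K" using K by auto
    then have K': "0 < K" "2 / K < \<epsilon>"
      using \<open>0 < \<epsilon>\<close> less_le_trans[of 0 "4 ^ k" K] by (auto simp: field_simps)
    obtain m where m: "m \<in> {\<nu> n + 1..c n - 1}" "c n - m \<in> {\<nu> n + 1..c n - 1}" "m \<le> c n"
      and w1: "layoff_weight (\<nu> n) (c n) m \<le> 1 / 2 ^ k"
      and w2: "layoff_weight (\<nu> n) (c n) (c n - m) \<le> 2 ^ k"
      using layoff_split[of "\<nu> n" "c n" k] M[OF n'(1)] by metis
    have weight_nonneg: "0 \<le> layoff_weight (\<nu> n) (c n) j" for j
      unfolding layoff_weight_def Let_def by simp
    have norm_m: "norm (e m) \<le> 1 / 2 ^ k" and norm_cm: "norm (e (c n - m)) \<le> 2 ^ k"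
      using layoff[OF n'(2) m(1)] layoff[OF n'(2) m(2)] w1 w2 weight_nonneg
      by (auto simp: norm_f)
    define w where "w = (1 / K) *\<^sub>R e (c n - m)"
    have "norm w \<le> 2 ^ k / 4 ^ k"
      unfolding w_def using norm_cm \<open>4 ^ k \<le> K\<close> K'(1)
      by (auto intro!: frac_le)
    also have "\<dots> = (1 / 2) ^ k"
      by (simp flip: power_divide)
    finally have "norm w < \<epsilon>" using k by simp
    moreover have "norm ((T ^^ m) w - e 0) < \<epsilon>"
    proof -
      have "(T ^^ m) w = (1 / K) *\<^sub>R e (c n)"
        unfolding w_def using linear_simps(5)[OF bounded_linear_funpow[OF bl]] e m(3) by simp
      then have "(T ^^ m) w - e 0 = (1 / K) *\<^sub>R (\<gamma> n *\<^sub>R f (c n) + (a n - K *\<^sub>R e 0))"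
        using K'(1) ec[OF n'(2)] unfolding a_def by (simp add: algebra_simps)
      moreover have "norm (\<gamma> n *\<^sub>R f (c n) + (a n - K *\<^sub>R e 0)) \<le> 2"
        using norm_triangle_ineq[of "\<gamma> n *\<^sub>R f (c n)" "a n - K *\<^sub>R e 0"] aK M[OF n'(1)] \<gamma>(1)[OF n'(2)]
        by (simp add: norm_f)
      ultimately have "norm ((T ^^ m) w - e 0) \<le> 2 / K"
        using K'(1) by (simp add: divide_right_mono)
      then show ?thesis using K'(2) by simp
    qed
    moreover have "norm ((T ^^ m) (e 0)) < \<epsilon>"
      using norm_m k e[of m 0] by (simp add: power_one_over)
    moreover have "N < m"
      using nat_le_strict_mono_on_positive[OF mono(1) n'(2)] \<nu>c[of 1] m(1) n'(3) by auto
    ultimately show ?thesis by blast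
  qed
  then show ?thesis
    using that[OF dense] by blast
qed

theorem theorem3p2:
  fixes smul :: "'k::{real_normed_field,euclidean_space} \<Rightarrow> 'x::banach \<Rightarrow> 'x"
    and T :: "'x \<Rightarrow> 'x"
  assumes "banach_space_over smul"
    and separable: "separable_space (euclidean :: 'x topology)"
    and "bounded_operator smul T"
    and "read_type smul T"
    and no_invariant_subset:
      "\<And>F. closed F \<Longrightarrow> T ` F \<subseteq> F \<Longrightarrow> F = {} \<or> F = {0} \<or> F = UNIV"
  shows "hypercyclic (map_prod T T) \<and> hypercyclicity_criterion T"
proof -
  have T: "bounded_linear T"
    using assms(1,3) by (rule bounded_operator_imp_bounded_linear)
  obtain x where "dense_set (range (\<lambda>j. (T ^^ j) x))"
    and "\<And>N \<epsilon>. 0 < \<epsilon> \<Longrightarrow>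
      \<exists>m>N. \<exists>w. norm w < \<epsilon> \<and> norm ((T ^^ m) w - x) < \<epsilon> \<and> norm ((T ^^ m) x) < \<epsilon>"
    using read_type_return[OF assms(1,3,4) no_invariant_subset] by metis
  then have "hypercyclicity_criterion T"
    using T by (intro hypercyclicity_criterion_of_dense_orbit)
  then show ?thesis
    using hypercyclicity_criterion_imp_hypercyclic_sum[OF separable T] by blast
qed

end
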